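(* Let $s>1$ be a fixed natural number, $A=\{0,1,\dots,s-1\}$, $N_B\subseteq\mathbb{N}$ a fixed subset, $\delta_n=2$ if $n\notin N_B$ and $\delta_n=1$ if $n\in N_B$, and write $\Delta^{(\pm s,B)}_{a_1a_2\dots}=\sum_{n\ge1}(-1)^{\delta_n}a_n s^{-n}$ for $a_n\in A$. Let $x'_0=-\sum_{n\in N_B}\frac{s-1}{s^n}$, $x''_0=\sum_{n\notin N_B}\frac{s-1}{s^n}$. Define sequences $(\beta_k)$, $(\gamma_k)$ by $\beta_k=0,\ \gamma_k=s-1$ if $k\notin N_B$ and $\beta_k=s-1,\ \gamma_k=0$ if $k\in N_B$. Then every number of $[x'_0;x''_0]$ has at most two quasi-nega-$s$-ary representations; the numbers having two representations form a countable subset of $[x'_0;x''_0]$ and are exactly those given by the following identities, valid for every $n\in\mathbb{N}$, all $\alpha_1,\dots,\alpha_{n-1}\in A$ and $\alpha_n\in A\setminus\{0\}$: (1) if $n\in N_B$ and $n+1\in N_B$: $\Delta^{(\pm s,B)}_{\alpha_1\dots\alpha_{n-1}[s-1-\alpha_n][s-1]\beta_{n+2}\beta_{n+3}\dots}=\Delta^{(\pm s,B)}_{\alpha_1\dots\alpha_{n-1}[s-\alpha_n]0\gamma_{n+2}\gamma_{n+3}\dots}$; (2) if $n\in N_B$ and $n+1\notin N_B$: $\Delta^{(\pm s,B)}_{\alpha_1\dots\alpha_{n-1}[s-1-\alpha_n]0\beta_{n+2}\beta_{n+3}\dots}=\Delta^{(\pm s,B)}_{\alpha_1\dots\alpha_{n-1}[s-\alpha_n][s-1]\gamma_{n+2}\gamma_{n+3}\dots}$;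 (3) if $n\notin N_B$ and $n+1\in N_B$: $\Delta^{(\pm s,B)}_{\alpha_1\dots\alpha_{n-1}\alpha_n[s-1]\beta_{n+2}\beta_{n+3}\dots}=\Delta^{(\pm s,B)}_{\alpha_1\dots\alpha_{n-1}[\alpha_n-1]0\gamma_{n+2}\gamma_{n+3}\dots}$; (4) if $n\notin N_B$ and $n+1\notin N_B$: $\Delta^{(\pm s,B)}_{\alpha_1\dots\alpha_{n-1}\alpha_n0\beta_{n+2}\beta_{n+3}\dots}=\Delta^{(\pm s,B)}_{\alpha_1\dots\alpha_{n-1}[\alpha_n-1][s-1]\gamma_{n+2}\gamma_{n+3}\dots}$.
   Context: A quasi-nega-$s$-ary representation of $x$ is a sequence $(a_n)$, $a_n\in A$, with $x=\sum_{n\ge1}(-1)^{\delta_n}a_n s^{-n}$. In the subscripts, brackets $[\cdot]$ denote a single digit given by the enclosed expression, and the digit sequence is listed position by position. *)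

theory Defs
  imports "HOL-Analysis.Analysis"
begin

text \<open>
  Positions are the positive integers. A digit sequence over \<open>A\<close> is an element of
  \<open>{1..} \<rightarrow>\<^sub>E A\<close>, so that its (meaningless) value at position 0 is pinned to
  \<^const>\<open>undefined\<close> and distinct functions are distinct sequences.
\<close>

definition digits :: "nat \<Rightarrow> nat set" where
  "digits s = {0..s - 1}"

definition delta :: "nat set \<Rightarrow> nat \<Rightarrow> nat" where
  "delta NB n = (if n \<in> NB then 1 else 2)"

definition qnega_term :: "nat \<Rightarrow> nat set \<Rightarrow> (nat \<Rightarrow> nat) \<Rightarrow> nat \<Rightarrow> real" where
  "qnega_term s NB a n = (- 1) ^ delta NB n * real (a n) / real s ^ n"

definition qnega_value :: "nat \<Rightarrow> nat set \<Rightarrow> (nat \<Rightarrow> nat) \<Rightarrow> real" where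
  "qnega_value s NB a = (\<Sum>\<^sub>\<infinity>n\<in>{1..}. qnega_term s NB a n)"

text \<open>The sum converges absolutely, hence it agrees with the ordered series.\<close>

lemma qnega_term_summable:
  assumes "s > 1" and "a \<in> {1..} \<rightarrow> digits s"
  shows "qnega_term s NB a summable_on {1..}"
    and "(\<lambda>n. qnega_term s NB a (Suc n)) sums qnega_value s NB a"
proof -
  have bound: "norm (qnega_term s NB a n) \<le> real s * (1 / real s) ^ n" if "n \<in> {1..}" for n
  proof -
    have "a n \<in> digits s" using assms(2) that by blast
    then have "real (a n) \<le> real s" by (simp add: digits_def)
    then have "real (a n) / real s ^ n \<le> real s / real s ^ n"
      by (rule divide_right_mono) simp
    then show ?thesis
      by (simp add: qnega_term_def delta_def power_one_over)
  qed
  have "summable (\<lambda>n. real s * (1 / real s) ^ n)"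
    using assms(1) by (intro summable_mult summable_geometric) simp
  then have "(\<lambda>n. real s * (1 / real s) ^ n) summable_on UNIV"
    by (simp add: summable_on_UNIV_nonneg_real_iff)
  then have "(\<lambda>n. real s * (1 / real s) ^ n) summable_on {1..}"
    by (rule summable_on_subset_banach) simp
  then show *: "qnega_term s NB a summable_on {1..}"
    using bound by (rule abs_summable_summable[OF Infinite_Sum.abs_summable_on_comparison_test'])
  have "bij_betw Suc UNIV {1..}"
    by (rule bij_betw_byWitness[where f' = "\<lambda>n. n - 1"]) auto
  then have "((\<lambda>n. qnega_term s NB a (Suc n)) has_sum qnega_value s NB a) UNIV"
    unfolding qnega_value_def
    by (subst has_sum_reindex_bij_betw[where f = "qnega_term s NB a"])
      (use has_sum_infsum[OF *] in simp_all)
  then show "(\<lambda>n. qnega_term s NB a (Suc n)) sums qnega_value s NB a"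
    by (rule has_sum_imp_sums)
qed

definition qnega_reps :: "nat \<Rightarrow> nat set \<Rightarrow> real \<Rightarrow> (nat \<Rightarrow> nat) set" where
  "qnega_reps s NB x = {a \<in> {1..} \<rightarrow>\<^sub>E digits s. x = qnega_value s NB a}"

definition x0_lower :: "nat \<Rightarrow> nat set \<Rightarrow> real" where
  "x0_lower s NB = - (\<Sum>\<^sub>\<infinity>n\<in>NB. (real s - 1) / real s ^ n)"

definition x0_upper :: "nat \<Rightarrow> nat set \<Rightarrow> real" where
  "x0_upper s NB = (\<Sum>\<^sub>\<infinity>n\<in>{1..} - NB. (real s - 1) / real s ^ n)"

definition beta :: "nat \<Rightarrow> nat set \<Rightarrow> nat \<Rightarrow> nat" where
  "beta s NB k = (if k \<in> NB then s - 1 else 0)"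

definition gamma :: "nat \<Rightarrow> nat set \<Rightarrow> nat \<Rightarrow> nat" where
  "gamma s NB k = (if k \<in> NB then 0 else s - 1)"

text \<open>
  \<open>digit_seq \<alpha> n c d t\<close> is the sequence
  \<open>\<alpha>\<^sub>1 \<dots> \<alpha>\<^sub>n\<^sub>-\<^sub>1 c d t\<^sub>n\<^sub>+\<^sub>2 t\<^sub>n\<^sub>+\<^sub>3 \<dots>\<close>.
\<close>

definition digit_seq ::
    "(nat \<Rightarrow> nat) \<Rightarrow> nat \<Rightarrow> nat \<Rightarrow> nat \<Rightarrow> (nat \<Rightarrow> nat) \<Rightarrow> nat \<Rightarrow> nat" where
  "digit_seq \<alpha> n c d t =
    (\<lambda>k\<in>{1..}. if k < n then \<alpha> k else if k = n then c else if k = n + 1 then d else t k)"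

text \<open>
  \<open>qnega_identity s NB a b\<close>: the sequences \<open>a\<close> and \<open>b\<close> are the left and right digit
  sequences of one of the four families of identities. No equality of values is built in.
\<close>

inductive qnega_identity :: "nat \<Rightarrow> nat set \<Rightarrow> (nat \<Rightarrow> nat) \<Rightarrow> (nat \<Rightarrow> nat) \<Rightarrow> bool"
  for s NB where
  in_in:
    "\<lbrakk>n \<ge> 1; \<forall>k\<in>{1..<n}. \<alpha> k \<in> digits s; \<alpha> n \<in> digits s - {0}; n \<in> NB; n + 1 \<in> NB\<rbrakk> \<Longrightarrow>
      qnega_identity s NB
        (digit_seq \<alpha> n (s - 1 - \<alpha> n) (s - 1) (beta s NB))
        (digit_seq \<alpha> n (s - \<alpha> n) 0 (gamma s NB))"
| in_out:
    "\<lbrakk>n \<ge> 1; \<forall>k\<in>{1..<n}. \<alpha> k \<in> digits s; \<alpha> n \<in> digits s - {0}; n \<in> NB; n + 1 \<notin> NB\<rbrakk> \<Longrightarrow>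
      qnega_identity s NB
        (digit_seq \<alpha> n (s - 1 - \<alpha> n) 0 (beta s NB))
        (digit_seq \<alpha> n (s - \<alpha> n) (s - 1) (gamma s NB))"
| out_in:
    "\<lbrakk>n \<ge> 1; \<forall>k\<in>{1..<n}. \<alpha> k \<in> digits s; \<alpha> n \<in> digits s - {0}; n \<notin> NB; n + 1 \<in> NB\<rbrakk> \<Longrightarrow>
      qnega_identity s NB
        (digit_seq \<alpha> n (\<alpha> n) (s - 1) (beta s NB))
        (digit_seq \<alpha> n (\<alpha> n - 1) 0 (gamma s NB))"
| out_out:
    "\<lbrakk>n \<ge> 1; \<forall>k\<in>{1..<n}. \<alpha> k \<in> digits s; \<alpha> n \<in> digits s - {0}; n \<notin> NB; n + 1 \<notin> NB\<rbrakk> \<Longrightarrow>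
      qnega_identity s NB
        (digit_seq \<alpha> n (\<alpha> n) 0 (beta s NB))
        (digit_seq \<alpha> n (\<alpha> n - 1) (s - 1) (gamma s NB))"

end

theory Submission
  imports Defs
begin

text \<open>
  Replacing the digit \<open>a\<^sub>n\<close> by \<open>s - 1 - a\<^sub>n\<close> at the positions \<open>n \<in> N\<^sub>B\<close> changes the value of every
  sequence by the same constant \<open>x'\<^sub>0\<close> and turns quasi-nega-\<open>s\<close>-ary representations into ordinary
  \<open>s\<close>-ary ones. Two ordinary expansions of the same number first differ by exactly one, and then the
  larger one continues with zeros and the smaller one with digits \<open>s - 1\<close>; the four families of
  identities are this situation, translated back. A sequence cannot end both in zeros and in
  digits \<open>s - 1\<close>, so there are never three representations, and a number with two representations
  differs from \<open>x'\<^sub>0\<close> by a terminating, hence rational, expansion.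
\<close>

section \<open>Passage to ordinary \<open>s\<close>-ary digits\<close>

definition flip_digit :: "nat \<Rightarrow> nat set \<Rightarrow> (nat \<Rightarrow> nat) \<Rightarrow> nat \<Rightarrow> nat" where
  "flip_digit s NB a k = (if k \<in> NB then s - 1 - a k else a k)"

text \<open>The pair is ordered: \<open>a\<close> is the expansion that terminates in ordinary
  digits, \<open>b\<close> the one ending in digits \<open>s - 1\<close>.\<close>

definition carry_pair :: "nat \<Rightarrow> nat set \<Rightarrow> nat \<Rightarrow> (nat \<Rightarrow> nat) \<Rightarrow> (nat \<Rightarrow> nat) \<Rightarrow> bool" where
  "carry_pair s NB n a b \<longleftrightarrow>
     n \<ge> 1 \<and> (\<forall>k\<in>{1..<n}. a k = b k) \<and> flip_digit s NB a n = flip_digit s NB b n + 1 \<and>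
     (\<forall>k>n. flip_digit s NB a k = 0 \<and> flip_digit s NB b k = s - 1)"

lemma flip_digit_le:
  assumes "a k \<in> digits s"
  shows "flip_digit s NB a k \<le> s - 1"
  using assms by (auto simp: flip_digit_def digits_def)

lemma flip_digit_eq_iff:
  assumes "a k \<in> digits s" and "b k \<in> digits s"
  shows "flip_digit s NB a k = flip_digit s NB b k \<longleftrightarrow> a k = b k"
  using assms by (auto simp: flip_digit_def digits_def)

text \<open>For \<open>k \<in> NB\<close> the sign is negative and complementing digits reverses
  their difference, so the two signs cancel. Taking differences removes the constant shift.\<close>

lemma qnega_term_diff:
  assumes "a k \<in> digits s" and "b k \<in> digits s"
  shows "qnega_term s NB a k - qnega_term s NB b k =
    (real (flip_digit s NB a k) - real (flip_digit s NB b k)) / real s ^ k"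
proof -
  have "real (s - 1 - a k) - real (s - 1 - b k) = real (b k) - real (a k)"
    using assms of_nat_diff[of "a k" "s - 1", where 'a = real]
      of_nat_diff[of "b k" "s - 1", where 'a = real]
    unfolding digits_def atLeastAtMost_iff by argo
  then show ?thesis
    by (simp add: qnega_term_def delta_def flip_digit_def flip: diff_divide_distrib)
qed

lemma qnega_value_diff_sums:
  assumes "s > 1" and "a \<in> {1..} \<rightarrow> digits s" and "b \<in> {1..} \<rightarrow> digits s"
  shows "(\<lambda>k. (real (flip_digit s NB a (Suc k)) - real (flip_digit s NB b (Suc k))) / real s ^ Suc k)
    sums (qnega_value s NB a - qnega_value s NB b)"
proof -
  have "a (Suc k) \<in> digits s" "b (Suc k) \<in> digits s" for k
    using assms(2,3) by auto
  then show ?thesis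
    using sums_diff[OF qnega_term_summable(2)[OF assms(1,2)] qnega_term_summable(2)[OF assms(1,3)],
        of NB NB]
    by (simp add: qnega_term_diff del: power_Suc)
qed

section \<open>Carries and equality of values\<close>

text \<open>This is the geometric identity behind a carry: one unit at position \<open>n\<close>
  equals digits \<open>s - 1\<close> at all later positions.\<close>

lemma carry_sums_zero:
  assumes "s > 1" and "n \<ge> 1"
  shows "(\<lambda>k. if n < Suc k then (real s - 1) / real s ^ Suc k
      else if Suc k = n then - 1 / real s ^ Suc k else 0) sums 0"
proof -
  \<comment> \<open>The cutoff below \<open>n\<close> makes the telescoping difference produce the
    term at \<open>n\<close>; since \<open>n \<ge> 1\<close>, \<open>g 0 = 0\<close> and the sum is
    zero.\<close>
  define g where "g k = (if k < n then 0 else (1 / real s) ^ k)" for k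
  have "(\<lambda>k. (1 / real s) ^ k) \<longlonglongrightarrow> 0"
    using assms(1) by (intro LIMSEQ_power_zero) simp
  moreover have "eventually (\<lambda>k. (1 / real s) ^ k = g k) sequentially"
    using eventually_ge_at_top[of n] by eventually_elim (simp add: g_def)
  ultimately have "g \<longlonglongrightarrow> 0"
    by (rule Lim_transform_eventually)
  then have "(\<lambda>k. g k - g (Suc k)) sums (g 0 - 0)"
    by (rule telescope_sums')
  moreover have "g k - g (Suc k) = (if n < Suc k then (real s - 1) / real s ^ Suc k
      else if Suc k = n then - 1 / real s ^ Suc k else 0)" for k
    using assms(1) by (auto simp: g_def power_one_over field_simps)
  ultimately show ?thesis
    using assms(2) by (simp add: g_def)
qed

text \<open>A convergent series of nonnegative terms is zero only if every term is. For the
  difference of values corrected by a carry at \<open>n\<close>, vanishing of all terms is exactly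
  the carry condition.\<close>

lemma qnega_value_eq_iff_carry_pair:
  assumes "s > 1" and a: "a \<in> {1..} \<rightarrow> digits s" and b: "b \<in> {1..} \<rightarrow> digits s"
    and "n \<ge> 1" and agree: "\<forall>k\<in>{1..<n}. a k = b k"
    and less: "flip_digit s NB b n < flip_digit s NB a n"
  shows "qnega_value s NB a = qnega_value s NB b \<longleftrightarrow> carry_pair s NB n a b"
proof -
  let ?fa = "\<lambda>k. real (flip_digit s NB a k)" and ?fb = "\<lambda>k. real (flip_digit s NB b k)"
  \<comment> \<open>Adding the null series of the carry makes all terms of the difference nonnegative.\<close>
  define e where "e k = (if n < k then ?fa k + (real s - 1 - ?fb k)
    else if k = n then ?fa k - ?fb k - 1 else 0)" for k
  have fb: "?fb k \<le> real s - 1" if "k \<ge> 1" for k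
    using flip_digit_le[of b k s NB] b that assms(1) by (force simp: Pi_iff)
  \<comment> \<open>At \<open>n\<close> integrality matters: the strict inequality of digits is a
    gap of at least 1.\<close>
  have e_nonneg: "e k \<ge> 0" if "k \<ge> 1" for k
    using fb[OF that] less by (auto simp: e_def)
  have "(?fa (Suc k) - ?fb (Suc k)) / real s ^ Suc k +
      (if n < Suc k then (real s - 1) / real s ^ Suc k
       else if Suc k = n then - 1 / real s ^ Suc k else 0) = e (Suc k) / real s ^ Suc k" for k
    using agree by (auto simp: e_def flip_digit_def add_divide_distrib diff_divide_distrib)
  then have sums: "(\<lambda>k. e (Suc k) / real s ^ Suc k) sums (qnega_value s NB a - qnega_value s NB b)"
    using sums_add[OF qnega_value_diff_sums[OF assms(1) a b] carry_sums_zero[OF assms(1,4)], of NB]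
    by simp
  have "qnega_value s NB a = qnega_value s NB b \<longleftrightarrow> (\<Sum>k. e (Suc k) / real s ^ Suc k) = 0"
    using sums_unique[OF sums] by auto
  also have "\<dots> \<longleftrightarrow> (\<forall>k. e (Suc k) / real s ^ Suc k = 0)"
    using sums e_nonneg by (intro suminf_eq_zero_iff) (auto simp: sums_iff)
  also have "\<dots> \<longleftrightarrow> (\<forall>k\<ge>1. e k = 0)"
    using assms(1) by (auto dest!: Suc_le_D)
  also have "\<dots> \<longleftrightarrow> carry_pair s NB n a b"
  proof
    assume zero: "\<forall>k\<ge>1. e k = 0"
    have "e n = 0"
      using zero assms(4) by blast
    then have "?fa n = ?fb n + 1"
      by (simp add: e_def)
    then have "flip_digit s NB a n = flip_digit s NB b n + 1"
      by linarith
    moreover have "flip_digit s NB a k = 0 \<and> flip_digit s NB b k = s - 1" if "k > n" for k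
    proof -
      have "e k = 0"
        using zero that by simp
      then have "?fa k + (real s - 1 - ?fb k) = 0"
        using that by (simp add: e_def)
      with fb[of k] that have "?fa k = 0" "?fb k = real s - 1"
        by auto
      then show ?thesis
        using assms(1) by linarith
    qed
    ultimately show "carry_pair s NB n a b"
      using assms(4) agree by (simp add: carry_pair_def)
  next
    assume "carry_pair s NB n a b"
    then show "\<forall>k\<ge>1. e k = 0"
      using assms(1) by (auto simp: carry_pair_def e_def of_nat_diff)
  qed
  finally show ?thesis .
qed

lemma qnega_value_eq_of_carry_pair:
  assumes "s > 1" and "a \<in> {1..} \<rightarrow> digits s" and "b \<in> {1..} \<rightarrow> digits s"
    and "carry_pair s NB n a b"
  shows "qnega_value s NB a = qnega_value s NB b"
  using qnega_value_eq_iff_carry_pair[OF assms(1-3), of n NB] assms(4)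
  by (simp add: carry_pair_def)

text \<open>The carry sits at the first position of disagreement; which sequence has the larger
  ordinary digit there decides the orientation.\<close>

lemma carry_pair_of_qnega_value_eq:
  assumes "s > 1" and a: "a \<in> {1..} \<rightarrow>\<^sub>E digits s" and b: "b \<in> {1..} \<rightarrow>\<^sub>E digits s"
    and "a \<noteq> b" and "qnega_value s NB a = qnega_value s NB b"
  shows "\<exists>n. carry_pair s NB n a b \<or> carry_pair s NB n b a"
proof -
  define n where "n = (LEAST k. k \<ge> 1 \<and> a k \<noteq> b k)"
  \<comment> \<open>Extensionality fixes the value at 0, so distinct sequences disagree at a
    positive position.\<close>
  have "\<exists>k. k \<ge> 1 \<and> a k \<noteq> b k"
    using PiE_ext[OF a b] assms(4) by auto
  then have n: "n \<ge> 1 \<and> a n \<noteq> b n"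
    unfolding n_def by (rule LeastI_ex)
  have agree: "\<forall>k\<in>{1..<n}. a k = b k"
    using not_less_Least[of _ "\<lambda>k. k \<ge> 1 \<and> a k \<noteq> b k", folded n_def] by force
  have ab: "a \<in> {1..} \<rightarrow> digits s" "b \<in> {1..} \<rightarrow> digits s"
    using a b by (auto simp: PiE_def)
  have "flip_digit s NB a n \<noteq> flip_digit s NB b n"
    using n ab by (subst flip_digit_eq_iff) (auto simp: Pi_iff)
  then consider "flip_digit s NB b n < flip_digit s NB a n"
    | "flip_digit s NB a n < flip_digit s NB b n"
    by linarith
  then show ?thesis
  proof cases
    case 1
    then show ?thesis
      using qnega_value_eq_iff_carry_pair[OF assms(1) ab] n agree assms(5) by blast
  next
    case 2
    moreover have "\<forall>k\<in>{1..<n}. b k = a k"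
      using agree by simp
    ultimately show ?thesis
      using qnega_value_eq_iff_carry_pair[OF assms(1) ab(2,1)] n assms(5) by metis
  qed
qed

text \<open>Beyond both \<open>n\<close> and \<open>m\<close>, the ordinary digits of
  \<open>b\<close> would be \<open>s - 1\<close> and 0 at once.\<close>

lemma carry_pair_not_chain:
  assumes "s > 1" and "carry_pair s NB n a b" and "carry_pair s NB m b c"
  shows False
proof -
  have "flip_digit s NB b (Suc (max n m)) = s - 1" "flip_digit s NB b (Suc (max n m)) = 0"
    using assms(2,3) unfolding carry_pair_def
    by (meson le_imp_less_Suc max.cobounded1 max.cobounded2)+
  then show False
    using assms(1) by simp
qed

section \<open>The four families of identities as carry pairs\<close>

lemma carry_pair_neq:
  assumes "carry_pair s NB n a b"
  shows "a \<noteq> b"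
  using assms by (auto simp: carry_pair_def)

lemma qnega_identity_digits:
  assumes "s > 1" and "qnega_identity s NB a b"
  shows "a \<in> {1..} \<rightarrow>\<^sub>E digits s" and "b \<in> {1..} \<rightarrow>\<^sub>E digits s"
  using assms(2,1)
  by (induction; auto simp: digit_seq_def digits_def beta_def gamma_def)+

text \<open>In each family the ordinary digit at \<open>n\<close> is \<open>\<alpha> n\<close> on
  the left and \<open>\<alpha> n - 1\<close> on the right, while \<open>beta\<close> becomes 0 and
  \<open>gamma\<close> becomes \<open>s - 1\<close>, also at \<open>n + 1\<close>.\<close>

lemma carry_pair_of_qnega_identity:
  assumes "s > 1" and "qnega_identity s NB a b"
  shows "\<exists>n. carry_pair s NB n a b"
  using assms(2)
proof cases
  case (in_in n \<alpha>)
  then have "carry_pair s NB n a b"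
    using assms(1)
    by (auto simp: carry_pair_def digit_seq_def flip_digit_def digits_def beta_def gamma_def)
  then show ?thesis ..
next
  case (in_out n \<alpha>)
  then have "carry_pair s NB n a b"
    using assms(1)
    by (auto simp: carry_pair_def digit_seq_def flip_digit_def digits_def beta_def gamma_def)
  then show ?thesis ..
next
  case (out_in n \<alpha>)
  then have "carry_pair s NB n a b"
    using assms(1)
    by (auto simp: carry_pair_def digit_seq_def flip_digit_def digits_def beta_def gamma_def)
  then show ?thesis ..
next
  case (out_out n \<alpha>)
  then have "carry_pair s NB n a b"
    using assms(1)
    by (auto simp: carry_pair_def digit_seq_def flip_digit_def digits_def beta_def gamma_def)
  then show ?thesis ..
qed

lemma qnega_identity_of_carry_pair:
  assumes "s > 1" and a: "a \<in> {1..} \<rightarrow>\<^sub>E digits s" and b: "b \<in> {1..} \<rightarrow>\<^sub>E digits s"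
    and carry: "carry_pair s NB n a b"
  shows "qnega_identity s NB a b"
proof -
  \<comment> \<open>The parameter at \<open>n\<close> is the ordinary digit of \<open>a\<close>; it
    is nonzero because it exceeds that of \<open>b\<close> by one.\<close>
  define \<alpha> where "\<alpha> = a(n := flip_digit s NB a n)"
  have n: "n \<ge> 1" and agree: "\<And>k. 1 \<le> k \<Longrightarrow> k < n \<Longrightarrow> a k = b k"
    and step: "flip_digit s NB a n = flip_digit s NB b n + 1"
    and tail: "\<And>k. k > n \<Longrightarrow> flip_digit s NB a k = 0 \<and> flip_digit s NB b k = s - 1"
    using carry by (auto simp: carry_pair_def)
  have le: "a k \<le> s - 1" "b k \<le> s - 1" if "k \<ge> 1" for k
    using a b that by (auto simp: PiE_iff digits_def)
  have tail_a: "a k = beta s NB k" if "k > n" for k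
    using tail[OF that] le[of k] that by (auto simp: beta_def flip_digit_def split: if_splits)
  have tail_b: "b k = gamma s NB k" if "k > n" for k
    using tail[OF that] le[of k] that by (auto simp: gamma_def flip_digit_def split: if_splits)
  have undef: "a 0 = undefined" "b 0 = undefined"
    using a b by (auto simp: PiE_iff extensional_def)
  \<comment> \<open>Keeping the digit at \<open>n + 1\<close> as a value of \<open>beta\<close> or
    \<open>gamma\<close> serves all four cases; it becomes 0 or \<open>s - 1\<close> once membership
    of \<open>n + 1\<close> is known.\<close>
  have seq_a: "a = digit_seq \<alpha> n (a n) (beta s NB (n + 1)) (beta s NB)"
    using tail_a undef by (auto simp: digit_seq_def \<alpha>_def fun_eq_iff not_less_eq_eq)
  have seq_b: "b = digit_seq \<alpha> n (b n) (gamma s NB (n + 1)) (gamma s NB)"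
    using tail_b undef agree by (auto simp: digit_seq_def \<alpha>_def fun_eq_iff not_less_eq_eq)
  have \<alpha>: "\<forall>k\<in>{1..<n}. \<alpha> k \<in> digits s" "\<alpha> n \<in> digits s - {0}"
    using a step flip_digit_le[of a n s NB] n by (auto simp: \<alpha>_def PiE_iff digits_def)
  have in_NB: "a n = s - 1 - \<alpha> n" "b n = s - \<alpha> n" if "n \<in> NB"
    using step le[OF n] that by (auto simp: \<alpha>_def flip_digit_def)
  have notin_NB: "a n = \<alpha> n" "b n = \<alpha> n - 1" if "n \<notin> NB"
    using step that by (auto simp: \<alpha>_def flip_digit_def)
  show ?thesis
  proof (cases "n \<in> NB"; cases "n + 1 \<in> NB")
    assume "n \<in> NB" "n + 1 \<in> NB"
    with qnega_identity.in_in[OF n \<alpha> this] show ?thesis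
      using seq_a seq_b in_NB by (simp add: beta_def gamma_def)
  next
    assume "n \<in> NB" "n + 1 \<notin> NB"
    with qnega_identity.in_out[OF n \<alpha> this] show ?thesis
      using seq_a seq_b in_NB by (simp add: beta_def gamma_def)
  next
    assume "n \<notin> NB" "n + 1 \<in> NB"
    with qnega_identity.out_in[OF n \<alpha> this] show ?thesis
      using seq_a seq_b notin_NB by (simp add: beta_def gamma_def)
  next
    assume "n \<notin> NB" "n + 1 \<notin> NB"
    with qnega_identity.out_out[OF n \<alpha> this] show ?thesis
      using seq_a seq_b notin_NB by (simp add: beta_def gamma_def)
  qed
qed

section \<open>At most two representations\<close>

text \<open>Among three distinct representations every two form a carry pair in some order. Any such
  orientation of three pairs contains a chain of length two, which is excluded.\<close>

lemma qnega_reps_card_le_2: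
  assumes "s > 1"
  shows "finite (qnega_reps s NB x) \<and> card (qnega_reps s NB x) \<le> 2"
proof (cases "\<exists>a b. a \<in> qnega_reps s NB x \<and> b \<in> qnega_reps s NB x \<and> a \<noteq> b")
  case True
  then obtain a b where ab: "a \<in> qnega_reps s NB x" "b \<in> qnega_reps s NB x" "a \<noteq> b"
    by blast
  have pair: "\<exists>n. carry_pair s NB n c d \<or> carry_pair s NB n d c"
    if "c \<in> qnega_reps s NB x" "d \<in> qnega_reps s NB x" "c \<noteq> d" for c d
    using carry_pair_of_qnega_value_eq[OF assms, of c d NB] that by (auto simp: qnega_reps_def)
  have "c = a \<or> c = b" if "c \<in> qnega_reps s NB x" for c
    using pair[of a b] pair[of a c] pair[of b c] ab that carry_pair_not_chain[OF assms, of NB]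
    by metis
  then have "qnega_reps s NB x \<subseteq> {a, b}"
    by blast
  then show ?thesis
    using card_mono[of "{a, b}" "qnega_reps s NB x"] ab(3) by (auto intro: finite_subset)
next
  case False
  then have "is_singleton (qnega_reps s NB x) \<or> qnega_reps s NB x = {}"
    by (metis is_singletonI')
  then show ?thesis
    by (auto simp: is_singleton_def)
qed

section \<open>Endpoints of the interval and rationality\<close>

lemma beta_digits: "beta s NB \<in> {1..} \<rightarrow> digits s"
  and gamma_digits: "gamma s NB \<in> {1..} \<rightarrow> digits s"
  by (auto simp: beta_def gamma_def digits_def)

lemma flip_digit_beta: "flip_digit s NB (beta s NB) k = 0"
  by (simp add: flip_digit_def beta_def)

lemma x0_lower_eq_qnega_value:
  assumes "s > 1" and "NB \<subseteq> {1..}"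
  shows "x0_lower s NB = qnega_value s NB (beta s NB)"
proof -
  have "qnega_value s NB (beta s NB) = (\<Sum>\<^sub>\<infinity>n\<in>NB. - ((real s - 1) / real s ^ n))"
    unfolding qnega_value_def using assms
    by (intro infsum_cong_neutral) (auto simp: qnega_term_def delta_def beta_def of_nat_diff
        diff_divide_distrib)
  then show ?thesis
    by (simp only: x0_lower_def infsum_uminus)
qed

lemma x0_upper_eq_qnega_value:
  assumes "s > 1"
  shows "x0_upper s NB = qnega_value s NB (gamma s NB)"
  unfolding qnega_value_def x0_upper_def using assms
  by (intro infsum_cong_neutral) (auto simp: qnega_term_def delta_def gamma_def of_nat_diff)

text \<open>Termwise comparison: \<open>beta\<close> minimizes and \<open>gamma\<close> maximizes
  each single term.\<close>

lemma qnega_value_bounds: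
  assumes "s > 1" and "NB \<subseteq> {1..}" and a: "a \<in> {1..} \<rightarrow> digits s"
  shows "qnega_value s NB a \<in> {x0_lower s NB..x0_upper s NB}"
proof -
  have "real (a k) \<le> real (s - 1)" if "k \<ge> 1" for k
    using a that by (auto simp: Pi_iff digits_def)
  then have a_le: "real (a k) / real s ^ k \<le> real (s - 1) / real s ^ k" if "k \<ge> 1" for k
    using that by (simp add: divide_right_mono)
  have "qnega_value s NB (beta s NB) \<le> qnega_value s NB a"
    unfolding qnega_value_def using a_le
    by (intro infsum_mono qnega_term_summable(1) assms beta_digits)
      (simp add: qnega_term_def delta_def beta_def)
  moreover have "qnega_value s NB a \<le> qnega_value s NB (gamma s NB)"
    unfolding qnega_value_def using a_le
    by (intro infsum_mono qnega_term_summable(1) assms gamma_digits)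
      (simp add: qnega_term_def delta_def gamma_def)
  ultimately show ?thesis
    using assms by (simp add: x0_lower_eq_qnega_value x0_upper_eq_qnega_value)
qed

text \<open>Relative to \<open>beta\<close>, whose ordinary digits are all 0, the expansion of
  \<open>a\<close> stops at \<open>n\<close>. Countability then follows from a translate of the
  rationals.\<close>

lemma carry_pair_value_rational:
  assumes "s > 1" and "NB \<subseteq> {1..}" and a: "a \<in> {1..} \<rightarrow> digits s"
    and carry: "carry_pair s NB n a b"
  shows "qnega_value s NB a - x0_lower s NB \<in> \<rat>"
proof -
  let ?t = "\<lambda>k. real (flip_digit s NB a (Suc k)) / real s ^ Suc k"
  have "?t sums (qnega_value s NB a - x0_lower s NB)"
    using qnega_value_diff_sums[OF assms(1) a beta_digits, of NB NB]
    by (simp add: x0_lower_eq_qnega_value[OF assms(1,2)] flip_digit_beta)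
  \<comment> \<open>The summation index is shifted by one, so \<open>{..<n}\<close> covers the
    positions 1 to \<open>n\<close>.\<close>
  moreover have "?t sums sum ?t {..<n}"
    using carry by (intro sums_finite) (auto simp: carry_pair_def)
  ultimately have "qnega_value s NB a - x0_lower s NB = sum ?t {..<n}"
    by (rule sums_unique2)
  also have "\<dots> \<in> \<rat>"
    by (intro Rats_sum Rats_divide Rats_power Rats_of_nat)
  finally show ?thesis .
qed

theorem theorem2:
  fixes s :: nat and NB :: "nat set"
  assumes "s > 1" and "NB \<subseteq> {1..}"
  shows "(\<forall>x\<in>{x0_lower s NB..x0_upper s NB}.
            finite (qnega_reps s NB x) \<and> card (qnega_reps s NB x) \<le> 2) \<and>
         {x. card (qnega_reps s NB x) = 2} \<subseteq> {x0_lower s NB..x0_upper s NB} \<and>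
         countable {x. card (qnega_reps s NB x) = 2} \<and>
         (\<forall>a b. qnega_identity s NB a b \<longrightarrow> qnega_value s NB a = qnega_value s NB b) \<and>
         {x. card (qnega_reps s NB x) = 2} =
           {x. \<exists>a b. qnega_identity s NB a b \<and>
                 x = qnega_value s NB a \<and> x = qnega_value s NB b}"
proof -
  have identity: "qnega_value s NB a = qnega_value s NB b" if "qnega_identity s NB a b" for a b
    using qnega_value_eq_of_carry_pair[OF assms(1)] qnega_identity_digits[OF assms(1) that]
      carry_pair_of_qnega_identity[OF assms(1) that] by (auto simp: PiE_def)
  have two_iff: "card (qnega_reps s NB x) = 2 \<longleftrightarrow>
    (\<exists>a b. qnega_identity s NB a b \<and> x = qnega_value s NB a \<and> x = qnega_value s NB b)" for x
  proof
    assume "card (qnega_reps s NB x) = 2"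
    then obtain a b where "qnega_reps s NB x = {a, b}" and neq: "a \<noteq> b"
      by (auto simp: card_2_iff)
    then have "a \<in> qnega_reps s NB x" "b \<in> qnega_reps s NB x"
      by auto
    then have ab: "a \<in> {1..} \<rightarrow>\<^sub>E digits s" "b \<in> {1..} \<rightarrow>\<^sub>E digits s"
      and x: "x = qnega_value s NB a" "x = qnega_value s NB b"
      unfolding qnega_reps_def by blast+
    \<comment> \<open>The orientation is unknown, but the claim is symmetric because both sequences
      have value \<open>x\<close>.\<close>
    have "qnega_identity s NB a b \<or> qnega_identity s NB b a"
      using carry_pair_of_qnega_value_eq[OF assms(1) ab neq, of NB] x
        qnega_identity_of_carry_pair[OF assms(1)] ab by metis
    then show "\<exists>a b. qnega_identity s NB a b \<and> x = qnega_value s NB a \<and> x = qnega_value s NB b"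
      using x by blast
  next
    assume "\<exists>a b. qnega_identity s NB a b \<and> x = qnega_value s NB a \<and> x = qnega_value s NB b"
    then obtain a b where ab: "qnega_identity s NB a b"
      and x: "x = qnega_value s NB a" "x = qnega_value s NB b"
      by blast
    have "{a, b} \<subseteq> qnega_reps s NB x"
      using qnega_identity_digits[OF assms(1) ab] x unfolding qnega_reps_def by blast
    moreover have "a \<noteq> b"
      using carry_pair_of_qnega_identity[OF assms(1) ab] carry_pair_neq by blast
    \<comment> \<open>Finiteness is needed here, since \<open>card\<close> of an infinite set is
      0.\<close>
    ultimately have "2 \<le> card (qnega_reps s NB x)"
      using card_mono[of "qnega_reps s NB x" "{a, b}"] qnega_reps_card_le_2[OF assms(1), of NB x]
      by simp
    then show "card (qnega_reps s NB x) = 2"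
      using qnega_reps_card_le_2[OF assms(1), of NB x] by simp
  qed
  have "x \<in> {x0_lower s NB..x0_upper s NB} \<and> x \<in> (\<lambda>q. x0_lower s NB + q) ` \<rat>"
    if two: "card (qnega_reps s NB x) = 2" for x
  proof -
    obtain a b where ab: "qnega_identity s NB a b" and x: "x = qnega_value s NB a"
      using two two_iff by blast
    have a: "a \<in> {1..} \<rightarrow> digits s"
      using qnega_identity_digits(1)[OF assms(1) ab] by (simp add: PiE_def)
    obtain n where "carry_pair s NB n a b"
      using carry_pair_of_qnega_identity[OF assms(1) ab] by blast
    then have "x - x0_lower s NB \<in> \<rat>"
      unfolding x by (rule carry_pair_value_rational[OF assms a])
    then have "x \<in> (\<lambda>q. x0_lower s NB + q) ` \<rat>"
      by (rule rev_image_eqI) simp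
    then show ?thesis
      using qnega_value_bounds[OF assms a] x by simp
  qed
  then have "{x. card (qnega_reps s NB x) = 2} \<subseteq> {x0_lower s NB..x0_upper s NB}"
    and "{x. card (qnega_reps s NB x) = 2} \<subseteq> (\<lambda>q. x0_lower s NB + q) ` \<rat>"
    by blast+
  moreover from this(2) have "countable {x. card (qnega_reps s NB x) = 2}"
    by (rule countable_subset) (intro countable_image countable_rat)
  ultimately show ?thesis
    using qnega_reps_card_le_2[OF assms(1)] identity two_iff by simp
qed

end
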